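(* Let $\alpha\in[0,1)$, suppose $S\in Map[\ell,k]$ is an optimal assignment map, and let $h,j\in\{1,\dots,\ell\}$ with $n_j\le n_h$. (i) If $S(h)=s^*\ne s$ for some $s\in\{1,\dots,k\}$, $\mathfrak{m}(\mathbf{b}_s)\ge n_j$, and $$\|y_j-y_h\|+\frac{\rho_\alpha(n_h+n_j,n_j)}{\rho_\alpha(\mathfrak{m}(\mathbf{b}_{s^*}),n_j)}\|y_h-x_{s^*}\|<\rho_\alpha(\mathfrak{m}(\mathbf{b}_s),n_j)\,\|y_j-x_s\|,$$ then $S(j)\ne s$. (ii) If $S(h)=s$ for some $s\in\{1,\dots,k\}$ and $$\|y_j-y_h\|+\frac{\rho_\alpha(n_h+n_j,n_j)}{\rho_\alpha(\mathfrak{m}(\mathbf{b}_s),n_j)}\|y_h-x_s\|<\rho_\alpha(\mathfrak{m}(\mathbf{b}_i),n_j)\,\|y_j-x_i\|$$ for every $i\ne s$ with $\mathfrak{m}(\mathbf{b}_i)\ge n_j$, then $S(j)=s$.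
   Context: $X\subset\mathbb{R}^m$ is compact and convex, $\|\cdot\|$ is the Euclidean norm, $\mathbf{x}=\{x_1,\dots,x_k\}\subset X$ is a set of $k$ points, $\mathbf{b}=\sum_{j=1}^\ell n_j\delta_{y_j}$ with $y_j\in X$, $n_j>0$, $\sum_j n_j=1$. The mass of an atomic measure $\mathbf{c}=\sum_i c_i\delta_{z_i}$ is $\mathfrak{m}(\mathbf{c})=\sum_i c_i$. For atomic measures $\mathbf{a},\mathbf{c}$ on $X$ of equal mass, a transport path from $\mathbf{a}$ to $\mathbf{c}$ is a weighted directed graph $G$ (without cycles) with finite vertex set $V(G)$ containing the atoms of $\mathbf{a}$ and $\mathbf{c}$, finite set $E(G)$ of directed edges which are line segments from $e^-$ to $e^+$, and weights $w:E(G)\to(0,\infty)$ such that for all $v\in V(G)$, $\sum_{e^-=v}w(e)=\sum_{e^+=v}w(e)+\mathbf{a}(\{v\})-\mathbf{c}(\{v\})$. $\mathbf{M}_\alpha(G)=\sum_{e\in E(G)}w(e)^\alpha\,length(e)$ and $d_\alpha(\mathbf{a},\mathbf{c})$ is the minimum of $\mathbf{M}_\alpha(G)$ over all transport paths from $\mathbf{a}$ to $\mathbf{c}$ ($0$ for zero measures). $Map[\ell,k]$ is the set of functions $S:\{1,\dots,\ell\}\to\{1,\dots,k\}$. For such $S$, $\mathbf{a}_i=\big(\sum_{j\in S^{-1}(i)}n_j\big)\delta_{x_i}$, $\mathbf{b}_i=\sum_{j\in S^{-1}(i)}n_j\delta_{y_j}$, so $\mathfrak{m}(\mathbf{b}_i)=\sum_{j\in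 S^{-1}(i)}n_j$, and $\mathbf{E}_\alpha(S;\mathbf{x},\mathbf{b})=\sum_{i=1}^kd_\alpha(\mathbf{a}_i,\mathbf{b}_i)$. $S$ is an optimal assignment map if it minimizes $\mathbf{E}_\alpha(\cdot\,;\mathbf{x},\mathbf{b})$ over $Map[\ell,k]$. For $\alpha\in(0,1)$ and $\sigma\ge\epsilon>0$, $\rho_\alpha(\sigma,\epsilon)=\left(\frac{\sigma}{\epsilon}\right)^\alpha-\left(\frac{\sigma}{\epsilon}-1\right)^\alpha$; for $\alpha=0$, $\rho_0(\sigma,\epsilon)=0$ if $\sigma>\epsilon>0$ and $\rho_0(\sigma,\epsilon)=1$ if $\sigma=\epsilon>0$. A quotient of the form $0/0$ (which can occur only for $\alpha=0$) is read as $0$. *)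

theory Defs
  imports "HOL-Analysis.Analysis" "HOL-Library.Poly_Mapping"
begin

text \<open>An atomic measure \<open>\<Sum>i. c\<^sub>i \<delta>\<^sub>z\<^sub>i\<close> is represented by its point-mass function
  \<open>v \<mapsto> c({v})\<close>, a finitely supported function; \<open>m \<delta>\<^sub>z\<close> is \<open>Poly_Mapping.single z m\<close>, and
  \<open>Poly_Mapping.keys c\<close> is the set of atoms. Coinciding points have their masses added.\<close>

type_synonym 'a atomic_measure = "'a \<Rightarrow>\<^sub>0 real"

definition mass :: "'a atomic_measure \<Rightarrow> real" where
  "mass c = (\<Sum>z\<in>Poly_Mapping.keys c. Poly_Mapping.lookup c z)"

text \<open>An edge is the pair \<open>(e\<^sup>-, e\<^sup>+)\<close> of its end points, standing for the directed line
  segment between them; \<open>acyclic\<close> excludes directed cycles, loops included.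
  The balance condition forces the two measures to have equal mass.\<close>

definition transport_path ::
  "'a atomic_measure \<Rightarrow> 'a atomic_measure \<Rightarrow> 'a set \<Rightarrow> ('a \<times> 'a) set \<Rightarrow> ('a \<times> 'a \<Rightarrow> real) \<Rightarrow> bool"
where
  "transport_path a c V E w \<longleftrightarrow>
     finite V \<and> Poly_Mapping.keys a \<union> Poly_Mapping.keys c \<subseteq> V \<and>
     finite E \<and> E \<subseteq> V \<times> V \<and> acyclic E \<and>
     (\<forall>e\<in>E. w e > 0) \<and>
     (\<forall>v\<in>V. (\<Sum>e\<in>{e\<in>E. fst e = v}. w e)
            = (\<Sum>e\<in>{e\<in>E. snd e = v}. w e) + Poly_Mapping.lookup a v - Poly_Mapping.lookup c v)"

text \<open>Weights on edges are positive, so for \<open>\<alpha> = 0\<close> every edge contributes its length.\<close>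

definition M_cost :: "real \<Rightarrow> ('a::metric_space \<times> 'a) set \<Rightarrow> ('a \<times> 'a \<Rightarrow> real) \<Rightarrow> real" where
  "M_cost \<alpha> E w = (\<Sum>e\<in>E. w e powr \<alpha> * dist (fst e) (snd e))"

text \<open>The minimum is taken as an infimum of nonnegative reals. For zero measures the empty graph
  is a transport path, so the value is \<open>0\<close>.\<close>

definition d_cost :: "real \<Rightarrow> 'a::metric_space atomic_measure \<Rightarrow> 'a atomic_measure \<Rightarrow> real" where
  "d_cost \<alpha> a c = Inf {M_cost \<alpha> E w | V E w. transport_path a c V E w}"

definition Maps :: "nat \<Rightarrow> nat \<Rightarrow> (nat \<Rightarrow> nat) set" where
  "Maps l k = {1..l} \<rightarrow>\<^sub>E {1..k}"

definition fiber :: "nat \<Rightarrow> (nat \<Rightarrow> nat) \<Rightarrow> nat \<Rightarrow> nat set" where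
  "fiber l S i = {j \<in> {1..l}. S j = i}"

definition source_part ::
  "nat \<Rightarrow> (nat \<Rightarrow> nat) \<Rightarrow> (nat \<Rightarrow> 'a) \<Rightarrow> (nat \<Rightarrow> real) \<Rightarrow> nat \<Rightarrow> 'a atomic_measure"
where
  "source_part l S x n i = Poly_Mapping.single (x i) (\<Sum>j\<in>fiber l S i. n j)"

definition target_part ::
  "nat \<Rightarrow> (nat \<Rightarrow> nat) \<Rightarrow> (nat \<Rightarrow> real) \<Rightarrow> (nat \<Rightarrow> 'a) \<Rightarrow> nat \<Rightarrow> 'a atomic_measure"
where
  "target_part l S n y i = (\<Sum>j\<in>fiber l S i. Poly_Mapping.single (y j) (n j))"

text \<open>Here \<open>b = \<Sum>j\<in>{1..l}. n\<^sub>j \<delta>\<^sub>y\<^sub>j\<close> enters through its data \<open>l\<close>, \<open>n\<close>, \<open>y\<close>, because assignment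
  maps act on the indices \<open>j\<close>.\<close>

definition assignment_cost ::
  "real \<Rightarrow> nat \<Rightarrow> nat \<Rightarrow> (nat \<Rightarrow> 'a::metric_space) \<Rightarrow> (nat \<Rightarrow> real) \<Rightarrow> (nat \<Rightarrow> 'a) \<Rightarrow> (nat \<Rightarrow> nat) \<Rightarrow> real"
where
  "assignment_cost \<alpha> l k x n y S =
     (\<Sum>i=1..k. d_cost \<alpha> (source_part l S x n i) (target_part l S n y i))"

definition optimal_assignment ::
  "real \<Rightarrow> nat \<Rightarrow> nat \<Rightarrow> (nat \<Rightarrow> 'a::metric_space) \<Rightarrow> (nat \<Rightarrow> real) \<Rightarrow> (nat \<Rightarrow> 'a) \<Rightarrow> (nat \<Rightarrow> nat) \<Rightarrow> bool"
where
  "optimal_assignment \<alpha> l k x n y S \<longleftrightarrow>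
     S \<in> Maps l k \<and>
     (\<forall>T\<in>Maps l k. assignment_cost \<alpha> l k x n y S \<le> assignment_cost \<alpha> l k x n y T)"

text \<open>Only meaningful for \<open>\<sigma> \<ge> \<epsilon> > 0\<close>. The reading \<open>0/0 = 0\<close> of quotients of \<open>\<rho>\<close>
  agrees with division by zero in HOL.\<close>

definition rho :: "real \<Rightarrow> real \<Rightarrow> real \<Rightarrow> real" where
  "rho \<alpha> \<sigma> \<epsilon> =
     (if \<alpha> = 0 then (if \<sigma> = \<epsilon> then 1 else 0)
      else (\<sigma> / \<epsilon>) powr \<alpha> - (\<sigma> / \<epsilon> - 1) powr \<alpha>)"

end

theory Submission
  imports Defs
begin

text \<open>If \<open>S j = s\<close>, compare \<open>S\<close> with the map sending \<open>j\<close> to \<open>S h\<close> instead. Concavity of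
  \<open>t \<mapsto> t\<^sup>\<alpha>\<close> lets us assume that (almost) optimal transport paths contain no undirected cycle, so
  that each target is reached from the source along one directed path, every edge of which
  carries at least the mass of that target. Taking mass \<open>n\<^sub>j\<close> off the path to \<open>y\<^sub>j\<close> saves at least
  \<open>n\<^sub>j\<^sup>\<alpha> \<rho> |y\<^sub>j - x\<^sub>s|\<close>. Sending it along the path to \<open>y\<^sub>h\<close> and then straight to \<open>y\<^sub>j\<close> costs at
  most \<open>n\<^sub>j\<^sup>\<alpha>\<close> times the left-hand side of the hypothesis.\<close>

subsection \<open>Concavity of powers and the function \<open>\<rho>\<close>\<close>

text \<open>Weighted Young inequality, multiplied by \<open>w powr (\<alpha> - 1)\<close>. Since
  \<open>0 powr 0 = 0\<close>, the power at \<alpha> = 0 is the indicator of the positive reals,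
  which is still concave on the nonnegative reals.\<close>

lemma powr_tangent_le:
  fixes u w \<alpha> :: real
  assumes "0 \<le> \<alpha>" "\<alpha> < 1" "0 < w" "0 \<le> u"
  shows "u powr \<alpha> \<le> w powr \<alpha> + \<alpha> * w powr (\<alpha> - 1) * (u - w)"
proof (cases "u = 0")
  case True
  have "\<alpha> * w powr \<alpha> \<le> w powr \<alpha>"
    using assms by (simp add: mult_left_le_one_le)
  then show ?thesis
    using True assms by (simp add: powr_diff)
next
  case False
  have "u powr \<alpha> * w powr (1 - \<alpha>) \<le> \<alpha> * u + (1 - \<alpha>) * w"
    using Youngs_inequality_0[of \<alpha> "1 - \<alpha>" u w] assms False by simp
  moreover have "(u powr \<alpha> * w powr (1 - \<alpha>)) * w powr (\<alpha> - 1) = u powr \<alpha>"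
    using assms by (simp add: powr_add[symmetric] mult.assoc)
  ultimately have "u powr \<alpha> \<le> (\<alpha> * u + (1 - \<alpha>) * w) * w powr (\<alpha> - 1)"
    by (metis mult_right_mono powr_ge_zero)
  also have "\<dots> = w powr \<alpha> + \<alpha> * w powr (\<alpha> - 1) * (u - w)"
    using assms by (simp add: powr_diff field_simps)
  finally show ?thesis .
qed

lemma powr_increment_antimono:
  fixes p q r \<alpha> :: real
  assumes "0 \<le> \<alpha>" "\<alpha> < 1" "0 < r" "r \<le> p" "p \<le> q"
  shows "q powr \<alpha> - (q - r) powr \<alpha> \<le> p powr \<alpha> - (p - r) powr \<alpha>"
proof (cases "p = q")
  case False
  define f where "f = (\<lambda>t::real. t powr \<alpha>)"
  \<comment> \<open>The chord inequality over the interval from \<open>p - r\<close> to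
    \<open>q\<close>, cleared of its denominator. The points \<open>p\<close> and
    \<open>q - r\<close> have mirrored weights, so the two instances add up to the claim. The
    tangent at \<open>c\<close> needs \<open>0 < c\<close>; for \<open>q - r\<close> this uses
    \<open>p < q\<close>, hence the separate case \<open>p = q\<close>.\<close>
  have conc: "(q - c) * f (p - r) + (c - (p - r)) * f q \<le> (q - p + r) * f c"
    if "0 < c" "p - r \<le> c" "c \<le> q" for c
  proof -
    let ?g = "\<alpha> * c powr (\<alpha> - 1)"
    have "f (p - r) \<le> f c + ?g * (p - r - c)" "f q \<le> f c + ?g * (q - c)"
      unfolding f_def using assms that by (auto intro: powr_tangent_le)
    then have "(q - c) * f (p - r) + (c - (p - r)) * f q
        \<le> (q - c) * (f c + ?g * (p - r - c)) + (c - (p - r)) * (f c + ?g * (q - c))"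
      using that by (intro add_mono mult_left_mono) auto
    also have "\<dots> = (q - p + r) * f c"
      by (simp add: algebra_simps)
    finally show ?thesis .
  qed
  have "(q - p + r) * (f (p - r) + f q) \<le> (q - p + r) * (f p + f (q - r))"
    using conc[of p] conc[of "q - r"] assms False by (simp add: algebra_simps)
  then have "f (p - r) + f q \<le> f p + f (q - r)"
    using assms by (subst (asm) mult_le_cancel_left_pos) auto
  then show ?thesis
    by (simp add: f_def)
qed simp

lemma powr_add_le:
  fixes a b \<alpha> :: real
  assumes "0 \<le> \<alpha>" "\<alpha> < 1" "0 \<le> a" "0 \<le> b"
  shows "(a + b) powr \<alpha> \<le> a powr \<alpha> + b powr \<alpha>"
proof (cases "b = 0")
  case False
  then show ?thesis
    using powr_increment_antimono[of \<alpha> b b "a + b"] assms by simp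
qed simp

text \<open>Turns \<rho> into an increment of the power function. By \<open>0 powr 0 = 0\<close>
  this also covers \<alpha> = 0, so that the cost estimates along paths need no case
  distinction.\<close>

lemma rho_scaled:
  assumes "0 < r" "r \<le> \<sigma>"
  shows "r powr \<alpha> * rho \<alpha> \<sigma> r = \<sigma> powr \<alpha> - (\<sigma> - r) powr \<alpha>"
proof (cases "\<alpha> = 0")
  case False
  have "\<sigma> / r - 1 = (\<sigma> - r) / r"
    using assms by (simp add: field_simps)
  then show ?thesis
    using False assms by (simp add: rho_def powr_divide right_diff_distrib)
qed (use assms in \<open>auto simp: rho_def\<close>)

lemma rho_pos:
  assumes "0 < \<alpha>" "0 < r" "r \<le> \<sigma>"
  shows "0 < rho \<alpha> \<sigma> r"
  using assms by (auto simp: rho_def intro!: powr_less_mono2)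

subsection \<open>Circulations\<close>

text \<open>The divergence of a weighted graph. A single sum makes it linear in \<open>w\<close>, of
  whatever sign, and gives it a value at every point, including points outside the graph.\<close>

definition netflow :: "('a \<times> 'a) set \<Rightarrow> ('a \<times> 'a \<Rightarrow> real) \<Rightarrow> 'a \<Rightarrow> real" where
  "netflow E w v = (\<Sum>e\<in>E. w e * (of_bool (fst e = v) - of_bool (snd e = v)))"

lemma netflow_add: "netflow E (\<lambda>e. f e + g e) v = netflow E f v + netflow E g v"
  by (simp add: netflow_def distrib_right sum.distrib)

lemma netflow_diff: "netflow E (\<lambda>e. f e - g e) v = netflow E f v - netflow E g v"
  by (simp add: netflow_def left_diff_distrib sum_subtractf)

lemma netflow_scale: "netflow E (\<lambda>e. c * f e) v = c * netflow E f v"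
  by (simp add: netflow_def sum_distrib_left mult.assoc)

lemma netflow_cong: "(\<And>e. e \<in> E \<Longrightarrow> f e = g e) \<Longrightarrow> netflow E f v = netflow E g v"
  by (simp add: netflow_def)

lemma netflow_mono_neutral:
  assumes "finite E" "E' \<subseteq> E" "\<And>e. e \<in> E - E' \<Longrightarrow> w e = 0"
  shows "netflow E' w v = netflow E w v"
  unfolding netflow_def using assms by (intro sum.mono_neutral_left) auto

lemma netflow_edge:
  assumes "finite E" "(a, b) \<in> E"
  shows "netflow E (\<lambda>e. of_bool (e = (a, b))) v = of_bool (v = a) - of_bool (v = b)"
proof -
  have "netflow E (\<lambda>e. of_bool (e = (a, b))) v = netflow {(a, b)} (\<lambda>e. of_bool (e = (a, b))) v"
    using assms by (intro netflow_mono_neutral[symmetric]) auto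
  then show ?thesis
    by (simp add: netflow_def eq_commute)
qed

lemma netflow_out_in:
  assumes "finite E"
  shows "netflow E w v = (\<Sum>e\<in>{e\<in>E. fst e = v}. w e) - (\<Sum>e\<in>{e\<in>E. snd e = v}. w e)"
proof -
  have "netflow E w v = (\<Sum>e\<in>E. if fst e = v then w e else 0) - (\<Sum>e\<in>E. if snd e = v then w e else 0)"
    unfolding netflow_def sum_subtractf[symmetric] by (intro sum.cong) auto
  then show ?thesis
    using assms by (simp add: sum.inter_filter)
qed

text \<open>The function \<open>\<phi>\<close> may be negative, so directions of edges do not matter here: the
  condition says that \<open>E\<close> is a forest as an undirected multigraph.\<close>

definition circulation_free :: "('a \<times> 'a) set \<Rightarrow> bool" where
  "circulation_free E \<longleftrightarrow> (\<forall>\<phi>. (\<forall>v. netflow E \<phi> v = 0) \<longrightarrow> (\<forall>e\<in>E. \<phi> e = 0))"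

text \<open>With \<open>g\<close> the gradient of the cost, \<open>D\<close> is the derivative in
  the direction \<phi>. As \<open>g\<close> is nonnegative, a negative \<open>D\<close> forces a
  negative entry of \<phi>; a positive \<open>D\<close> is handled by reversing \<phi>. If
  \<open>D = 0\<close>, either sign is allowed, and the one that makes the given entry negative is
  taken.\<close>

lemma exists_nonincreasing_direction:
  fixes \<phi> g :: "'b \<Rightarrow> real"
  assumes "finite E" "\<And>e. e \<in> E \<Longrightarrow> 0 \<le> g e" "e \<in> E" "\<phi> e \<noteq> 0"
  obtains s :: real where "(\<Sum>e\<in>E. g e * (s * \<phi> e)) \<le> 0" "\<exists>e\<in>E. s * \<phi> e < 0"
proof -
  define D where "D = (\<Sum>e\<in>E. g e * \<phi> e)"
  have D: "(\<Sum>e\<in>E. g e * (s * \<phi> e)) = s * D" for s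
    by (simp add: D_def sum_distrib_left mult_ac)
  consider "D = 0" | "D < 0" | "D > 0"
    by linarith
  then show thesis
  proof cases
    case 1
    show thesis
    proof (rule that[of "- sgn (\<phi> e)"])
      show "(\<Sum>e'\<in>E. g e' * (- sgn (\<phi> e) * \<phi> e')) \<le> 0"
        by (simp only: D 1)
      show "\<exists>e'\<in>E. - sgn (\<phi> e) * \<phi> e' < 0"
        using assms by (intro bexI[of _ e]) (auto simp: sgn_if)
    qed
  next
    case 2
    have "\<exists>e\<in>E. \<phi> e < 0"
    proof (rule ccontr)
      assume "\<not> ?thesis"
      then have "D \<ge> 0"
        unfolding D_def using assms by (intro sum_nonneg mult_nonneg_nonneg) auto
      then show False using 2 by simp
    qed
    then show thesis
      using that[of 1] 2 by (simp add: D_def)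
  next
    case 3
    have "\<exists>e\<in>E. \<phi> e > 0"
    proof (rule ccontr)
      assume "\<not> ?thesis"
      then have "D \<le> 0"
        unfolding D_def using assms by (intro sum_nonpos mult_nonneg_nonpos) force+
      then show False using 3 by simp
    qed
    then show thesis
      using that[of "-1"] 3 by (simp add: D_def sum_negf)
  qed
qed

text \<open>Along a circulation the cost is a concave function of the parameter, so one of the two
  directions does not increase it; follow that direction until an edge becomes empty.\<close>

lemma drop_edge_along_circulation:
  fixes E :: "('a::metric_space \<times> 'a) set"
  assumes \<alpha>: "0 \<le> \<alpha>" "\<alpha> < 1" and "finite E" and pos: "\<And>e. e \<in> E \<Longrightarrow> 0 < w e"
    and circ: "\<And>v. netflow E \<phi> v = 0" and "e0 \<in> E" "\<phi> e0 \<noteq> 0"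
  obtains E' w' where "E' \<subset> E" "\<And>e. e \<in> E' \<Longrightarrow> 0 < w' e"
    "\<And>v. netflow E' w' v = netflow E w v" "M_cost \<alpha> E' w' \<le> M_cost \<alpha> E w"
proof -
  \<comment> \<open>The derivative of the cost with respect to the weight of
    \<open>e\<close>.\<close>
  define g where "g e = \<alpha> * w e powr (\<alpha> - 1) * dist (fst e) (snd e)" for e
  obtain s where s: "(\<Sum>e\<in>E. g e * (s * \<phi> e)) \<le> 0" "\<exists>e\<in>E. s * \<phi> e < 0"
    using exists_nonincreasing_direction[of E g e0 \<phi>] assms by (auto simp: g_def)
  define \<psi> where "\<psi> = (\<lambda>e. s * \<phi> e)"
  define N where "N = {e\<in>E. \<psi> e < 0}"
  \<comment> \<open>The first parameter at which some edge becomes empty; up to it all weights stay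
    nonnegative.\<close>
  define t where "t = Min ((\<lambda>e. w e / (- \<psi> e)) ` N)"
  have N: "finite N" "N \<noteq> {}"
    using s assms by (auto simp: N_def \<psi>_def)
  then obtain e1 where e1: "e1 \<in> N" "t = w e1 / (- \<psi> e1)"
    unfolding t_def by (metis (mono_tags, lifting) Min_in finite_imageI image_iff image_is_empty)
  have t_le: "t \<le> w e / (- \<psi> e)" if "e \<in> N" for e
    unfolding t_def using N that by auto
  have "0 < t"
    using e1 pos[of e1] by (auto simp: N_def intro!: divide_pos_neg)
  define w' where "w' = (\<lambda>e. w e + t * \<psi> e)"
  have w'_nonneg: "0 \<le> w' e" if "e \<in> E" for e
  proof (cases "\<psi> e < 0")
    case True
    then have "t * (- \<psi> e) \<le> w e"
      using t_le[of e] that by (auto simp: N_def field_simps)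
    then show ?thesis
      by (simp add: w'_def)
  next
    case False
    then show ?thesis
      using \<open>0 < t\<close> pos[OF that] by (simp add: w'_def)
  qed
  have "w' e1 = 0"
    using e1 by (auto simp: w'_def N_def)
  define E' where "E' = {e\<in>E. w' e \<noteq> 0}"
  have "E' \<subset> E"
    using \<open>w' e1 = 0\<close> e1 by (auto simp: E'_def N_def)
  moreover have "0 < w' e" if "e \<in> E'" for e
    using w'_nonneg[of e] that by (auto simp: E'_def)
  moreover have "netflow E' w' v = netflow E w v" for v
  proof -
    have "netflow E' w' v = netflow E w' v"
      using assms by (intro netflow_mono_neutral) (auto simp: E'_def)
    then show ?thesis
      by (simp add: w'_def \<psi>_def netflow_add netflow_scale circ)
  qed
  moreover have "M_cost \<alpha> E' w' \<le> M_cost \<alpha> E w"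
  proof -
    have "M_cost \<alpha> E' w' = M_cost \<alpha> E w'"
      unfolding M_cost_def using assms by (intro sum.mono_neutral_left) (auto simp: E'_def)
    also have "\<dots> \<le> (\<Sum>e\<in>E. w e powr \<alpha> * dist (fst e) (snd e) + t * (g e * \<psi> e))"
      unfolding M_cost_def
    proof (rule sum_mono)
      fix e assume e: "e \<in> E"
      have "w' e powr \<alpha> \<le> w e powr \<alpha> + \<alpha> * w e powr (\<alpha> - 1) * (w' e - w e)"
        using e \<alpha> pos w'_nonneg by (intro powr_tangent_le)
      then have "w' e powr \<alpha> * dist (fst e) (snd e)
          \<le> (w e powr \<alpha> + \<alpha> * w e powr (\<alpha> - 1) * (w' e - w e)) * dist (fst e) (snd e)"
        by (intro mult_right_mono) auto
      then show "w' e powr \<alpha> * dist (fst e) (snd e)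
          \<le> w e powr \<alpha> * dist (fst e) (snd e) + t * (g e * \<psi> e)"
        by (simp add: w'_def g_def algebra_simps)
    qed
    also have "\<dots> = M_cost \<alpha> E w + t * (\<Sum>e\<in>E. g e * \<psi> e)"
      by (simp add: M_cost_def sum.distrib sum_distrib_left)
    also have "\<dots> \<le> M_cost \<alpha> E w"
      using s \<open>0 < t\<close> by (simp add: \<psi>_def mult_nonneg_nonpos)
    finally show ?thesis .
  qed
  ultimately show thesis
    by (rule that)
qed

lemma reduce_to_circulation_free:
  fixes E :: "('a::metric_space \<times> 'a) set"
  assumes "0 \<le> \<alpha>" "\<alpha> < 1" "finite E" "\<And>e. e \<in> E \<Longrightarrow> 0 < w e"
  obtains E' w' where "finite E'" "circulation_free E'" "\<And>e. e \<in> E' \<Longrightarrow> 0 < w' e"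
    "\<And>v. netflow E' w' v = netflow E w v" "M_cost \<alpha> E' w' \<le> M_cost \<alpha> E w"
  using assms(3,4)
proof (induction E arbitrary: w thesis rule: finite_psubset_induct)
  case (psubset E)
  show ?case
  proof (cases "circulation_free E")
    case True
    then show ?thesis
      using psubset by blast
  next
    case False
    then obtain \<phi> e0 where "\<And>v. netflow E \<phi> v = 0" "e0 \<in> E" "\<phi> e0 \<noteq> 0"
      by (auto simp: circulation_free_def)
    then obtain E1 w1 where 1: "E1 \<subset> E" "\<And>e. e \<in> E1 \<Longrightarrow> 0 < w1 e"
      "\<And>v. netflow E1 w1 v = netflow E w v" "M_cost \<alpha> E1 w1 \<le> M_cost \<alpha> E w"
      using drop_edge_along_circulation[of \<alpha> E w \<phi> e0] assms(1,2) psubset by metis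
    obtain E2 w2 where "finite E2" "circulation_free E2" "\<And>e. e \<in> E2 \<Longrightarrow> 0 < w2 e"
      "\<And>v. netflow E2 w2 v = netflow E1 w1 v" "M_cost \<alpha> E2 w2 \<le> M_cost \<alpha> E1 w1"
      using psubset.IH[OF 1(1), of w1] 1 by metis
    then show ?thesis
      using 1 psubset.prems(1)[of E2 w2] by force
  qed
qed

text \<open>One unit is pushed along a directed walk. The clause about \<open>snd e\<close> records
  that every edge used can still reach the end point, which later rules out overlaps in acyclic
  graphs.\<close>

lemma unit_flow:
  assumes "finite E" "(u, v) \<in> E\<^sup>*"
  obtains \<phi> where "\<And>e. 0 \<le> \<phi> e" "\<And>e. \<phi> e \<noteq> 0 \<Longrightarrow> (snd e, v) \<in> E\<^sup>*"
    "\<And>z. netflow E \<phi> z = of_bool (z = u) - of_bool (z = v)"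
  using assms(2)
proof (induction arbitrary: thesis rule: rtrancl_induct)
  case base
  show ?case
    by (rule base[of "\<lambda>_. 0"]) (auto simp: netflow_def)
next
  case (step v v')
  obtain \<phi> where \<phi>: "\<And>e. 0 \<le> \<phi> e" "\<And>e. \<phi> e \<noteq> 0 \<Longrightarrow> (snd e, v) \<in> E\<^sup>*"
    "\<And>z. netflow E \<phi> z = of_bool (z = u) - of_bool (z = v)"
    using step.IH by blast
  show ?case
  proof (rule step.prems[of "\<lambda>e. \<phi> e + of_bool (e = (v, v'))"])
    show "netflow E (\<lambda>e. \<phi> e + of_bool (e = (v, v'))) z = of_bool (z = u) - of_bool (z = v')" for z
      using step.hyps assms(1) by (simp add: netflow_add netflow_edge \<phi>)
    show "(snd e, v') \<in> E\<^sup>*" if "\<phi> e + of_bool (e = (v, v')) \<noteq> 0" for e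
      using that \<phi>(2)[of e] step.hyps by (cases "e = (v, v')") auto
  qed (use \<phi> in auto)
qed

text \<open>A directed cycle would carry a circulation. Its value on the closing edge is at least 1,
  because the flow along the rest of the cycle is nonnegative.\<close>

lemma circulation_free_acyclic:
  assumes "finite E" "circulation_free E"
  shows "acyclic E"
proof (rule acyclicI, intro allI notI)
  fix v assume "(v, v) \<in> E\<^sup>+"
  then obtain u where u: "(v, u) \<in> E" "(u, v) \<in> E\<^sup>*"
    by (meson tranclD)
  obtain \<phi> where \<phi>: "\<And>e. 0 \<le> \<phi> e"
    "\<And>z. netflow E \<phi> z = of_bool (z = u) - of_bool (z = v)"
    using unit_flow[OF assms(1) u(2)] by metis
  have "netflow E (\<lambda>e. \<phi> e + of_bool (e = (v, u))) z = 0" for z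
    using u assms by (simp add: netflow_add netflow_edge \<phi>)
  then have "\<phi> (v, u) + of_bool ((v, u) = (v, u)) = 0"
    using assms(2) u(1) unfolding circulation_free_def by blast
  then show False
    using \<phi>(1)[of "(v, u)"] by simp
qed

text \<open>The difference of two walks from \<open>r\<close> to \<open>v\<close>, ending with
  different edges, is a circulation. It can vanish on \<open>(u1, v)\<close> only if the second walk
  passes through that edge before reaching \<open>u2\<close>, and then \<open>v\<close> lies on a
  directed cycle.\<close>

lemma circulation_free_indegree:
  assumes "finite E" "circulation_free E" "(u1, v) \<in> E" "(u2, v) \<in> E"
    "(r, u1) \<in> E\<^sup>*" "(r, u2) \<in> E\<^sup>*"
  shows "u1 = u2"
proof (rule ccontr)
  assume "u1 \<noteq> u2"
  obtain \<phi>1 where \<phi>1: "\<And>e. 0 \<le> \<phi>1 e" "\<And>z. netflow E \<phi>1 z = of_bool (z = r) - of_bool (z = u1)"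
    using unit_flow[OF assms(1,5)] by metis
  obtain \<phi>2 where \<phi>2: "\<And>e. \<phi>2 e \<noteq> 0 \<Longrightarrow> (snd e, u2) \<in> E\<^sup>*"
    "\<And>z. netflow E \<phi>2 z = of_bool (z = r) - of_bool (z = u2)"
    using unit_flow[OF assms(1,6)] by metis
  let ?\<phi> = "\<lambda>e. (\<phi>1 e + of_bool (e = (u1, v))) - (\<phi>2 e + of_bool (e = (u2, v)))"
  have "netflow E ?\<phi> z = 0" for z
    using assms by (simp add: netflow_diff netflow_add netflow_edge \<phi>1 \<phi>2)
  then have "?\<phi> (u1, v) = 0"
    using assms(2,3) unfolding circulation_free_def by blast
  then have "\<phi>2 (u1, v) \<noteq> 0"
    using \<phi>1(1)[of "(u1, v)"] \<open>u1 \<noteq> u2\<close> by auto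
  then have "(v, v) \<in> E\<^sup>+"
    using \<phi>2(1) assms(4) by force
  then show False
    using circulation_free_acyclic[OF assms(1,2)] by (simp add: acyclic_def)
qed

subsection \<open>Transport paths as flows\<close>

lemma transport_path_netflow:
  assumes "transport_path a c V E w"
  shows "netflow E w v = Poly_Mapping.lookup a v - Poly_Mapping.lookup c v"
proof (cases "v \<in> V")
  case True
  then show ?thesis
    using assms by (simp add: transport_path_def netflow_out_in)
next
  case False
  then have "netflow E w v = 0" "v \<notin> Poly_Mapping.keys a" "v \<notin> Poly_Mapping.keys c"
    using assms unfolding transport_path_def netflow_def by (auto intro!: sum.neutral)
  then show ?thesis
    by (simp add: in_keys_iff)
qed

text \<open>Dropping empty edges and reducing to a forest gives positivity and acyclicity at no
  extra cost. Upper bounds for \<open>d_cost\<close> therefore need only a nonnegative flow, with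
  cycles allowed.\<close>

lemma flow_imp_transport_path:
  fixes a c :: "'a::metric_space atomic_measure"
  assumes "0 \<le> \<alpha>" "\<alpha> < 1" "finite E" "\<And>e. e \<in> E \<Longrightarrow> 0 \<le> w e"
    and flow: "\<And>v. netflow E w v = Poly_Mapping.lookup a v - Poly_Mapping.lookup c v"
  obtains V E' w' where "transport_path a c V E' w'" "M_cost \<alpha> E' w' \<le> M_cost \<alpha> E w"
proof -
  define E0 where "E0 = {e\<in>E. w e \<noteq> 0}"
  have "finite E0" "\<And>e. e \<in> E0 \<Longrightarrow> 0 < w e"
    using assms(3,4) by (force simp: E0_def)+
  then obtain E' w' where E': "finite E'" "circulation_free E'" "\<And>e. e \<in> E' \<Longrightarrow> 0 < w' e"
    "\<And>v. netflow E' w' v = netflow E0 w v" "M_cost \<alpha> E' w' \<le> M_cost \<alpha> E0 w"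
    using reduce_to_circulation_free[of \<alpha> E0 w] assms(1,2) by metis
  have "netflow E0 w v = netflow E w v" for v
    using assms by (intro netflow_mono_neutral) (auto simp: E0_def)
  moreover have "M_cost \<alpha> E0 w = M_cost \<alpha> E w"
    unfolding M_cost_def using assms by (intro sum.mono_neutral_left) (auto simp: E0_def)
  moreover define V where "V = fst ` E' \<union> snd ` E' \<union> Poly_Mapping.keys a \<union> Poly_Mapping.keys c"
  moreover have "E' \<subseteq> V \<times> V"
    by (force simp: V_def)
  ultimately have "transport_path a c V E' w'" "M_cost \<alpha> E' w' \<le> M_cost \<alpha> E w"
    using E' circulation_free_acyclic[OF E'(1,2)] flow netflow_out_in[OF E'(1), of w']
    unfolding transport_path_def by (auto simp: algebra_simps)
  then show thesis
    by (rule that)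
qed

lemma M_cost_nonneg: "0 \<le> M_cost \<alpha> E w"
  unfolding M_cost_def by (intro sum_nonneg) auto

lemma bdd_below_M_cost: "bdd_below {M_cost \<alpha> E w | V E w. transport_path a c V E w}"
  using M_cost_nonneg by (intro bdd_belowI[of _ 0]) auto

lemma d_cost_le_flow:
  fixes a c :: "'a::metric_space atomic_measure"
  assumes "0 \<le> \<alpha>" "\<alpha> < 1" "finite E" "\<And>e. e \<in> E \<Longrightarrow> 0 \<le> w e"
    and "\<And>v. netflow E w v = Poly_Mapping.lookup a v - Poly_Mapping.lookup c v"
  shows "d_cost \<alpha> a c \<le> M_cost \<alpha> E w"
proof -
  obtain V E' w' where "transport_path a c V E' w'" "M_cost \<alpha> E' w' \<le> M_cost \<alpha> E w"
    using flow_imp_transport_path[OF assms] by blast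
  then show ?thesis
    unfolding d_cost_def by (intro cInf_lower2[OF _ _ bdd_below_M_cost]) auto
qed

text \<open>The edge \<open>(p, q)\<close> may already belong to \<open>E\<close>; its weights then
  add up, and subadditivity of the power still bounds the extra cost by that of a separate
  edge.\<close>

lemma d_cost_le_flow_plus_edge:
  fixes a c :: "'a::metric_space atomic_measure"
  assumes \<alpha>: "0 \<le> \<alpha>" "\<alpha> < 1" and "finite E" "\<And>e. e \<in> E \<Longrightarrow> 0 \<le> w e" and "0 \<le> r"
    and flow: "\<And>v. netflow E w v + r * (of_bool (v = p) - of_bool (v = q))
      = Poly_Mapping.lookup a v - Poly_Mapping.lookup c v"
  shows "d_cost \<alpha> a c \<le> M_cost \<alpha> E w + r powr \<alpha> * dist p q"
proof -
  define E1 where "E1 = insert (p, q) E"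
  define w0 where "w0 e = (if e \<in> E then w e else 0)" for e
  define w1 where "w1 = (\<lambda>e. w0 e + r * of_bool (e = (p, q)))"
  have E1: "finite E1" "E \<subseteq> E1" "(p, q) \<in> E1"
    using assms by (auto simp: E1_def)
  have w0: "0 \<le> w0 e" for e
    using assms by (auto simp: w0_def)
  have "netflow E1 w0 v = netflow E w v" for v
    using netflow_mono_neutral[OF E1(1,2), of w0 v] netflow_cong[of E w0 w v] by (simp add: w0_def)
  then have "netflow E1 w1 v = Poly_Mapping.lookup a v - Poly_Mapping.lookup c v" for v
    using E1 by (simp add: w1_def netflow_add netflow_scale netflow_edge flow)
  then have "d_cost \<alpha> a c \<le> M_cost \<alpha> E1 w1"
    using assms E1 w0 by (intro d_cost_le_flow) (auto simp: w1_def)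
  also have "\<dots> \<le> (\<Sum>e\<in>E1. w0 e powr \<alpha> * dist (fst e) (snd e)
      + (if e = (p, q) then r powr \<alpha> * dist p q else 0))"
    unfolding M_cost_def
  proof (rule sum_mono)
    fix e
    have "(w0 e + r) powr \<alpha> * dist (fst e) (snd e)
        \<le> (w0 e powr \<alpha> + r powr \<alpha>) * dist (fst e) (snd e)"
      using \<alpha> w0 \<open>0 \<le> r\<close> by (intro mult_right_mono powr_add_le) auto
    then show "w1 e powr \<alpha> * dist (fst e) (snd e) \<le> w0 e powr \<alpha> * dist (fst e) (snd e)
      + (if e = (p, q) then r powr \<alpha> * dist p q else 0)"
      by (auto simp: w1_def algebra_simps)
  qed
  also have "\<dots> = M_cost \<alpha> E1 w0 + r powr \<alpha> * dist p q"
    using E1 by (simp add: M_cost_def sum.distrib)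
  also have "M_cost \<alpha> E1 w0 = M_cost \<alpha> E w"
    unfolding M_cost_def using E1
    by (intro sum.mono_neutral_cong_right) (auto simp: w0_def)
  finally show ?thesis .
qed

lemma netflow_star:
  assumes "finite A"
  shows "netflow ({x} \<times> A) (\<lambda>e. f (snd e)) v = (\<Sum>z\<in>A. f z) * of_bool (v = x) - (if v \<in> A then f v else 0)"
proof -
  have "netflow ({x} \<times> A) (\<lambda>e. f (snd e)) v = (\<Sum>z\<in>A. f z * (of_bool (x = v) - of_bool (z = v)))"
    unfolding netflow_def by (intro sum.reindex_bij_witness[of _ "\<lambda>z. (x, z)" snd]) auto
  also have "\<dots> = (\<Sum>z\<in>A. f z) * of_bool (v = x) - (\<Sum>z\<in>A. if z = v then f z else 0)"
    unfolding sum_distrib_right sum_subtractf[symmetric] by (intro sum.cong) auto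
  finally show ?thesis
    using assms by simp
qed

text \<open>A star with an edge from \<open>x\<close> to each atom. This makes the infimum in
  \<open>d_cost\<close> range over a nonempty set.\<close>

lemma exists_transport_path:
  fixes c :: "'a::metric_space atomic_measure"
  assumes "\<And>v. 0 \<le> Poly_Mapping.lookup c v"
  obtains V E w where "transport_path (Poly_Mapping.single x (mass c)) c V E w"
proof -
  have "netflow ({x} \<times> Poly_Mapping.keys c) (\<lambda>e. Poly_Mapping.lookup c (snd e)) v
      = Poly_Mapping.lookup (Poly_Mapping.single x (mass c)) v - Poly_Mapping.lookup c v" for v
    by (simp add: netflow_star mass_def lookup_single when_def in_keys_iff)
  then show thesis
    using flow_imp_transport_path[of 0 "{x} \<times> Poly_Mapping.keys c"
        "\<lambda>e. Poly_Mapping.lookup c (snd e)" "Poly_Mapping.single x (mass c)" c] that assms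
    by (metis finite_SigmaI finite.emptyI finite_insert finite_keys order_refl zero_less_one)
qed

subsection \<open>Paths from a single source\<close>

text \<open>Going backwards along edges must stop in a finite acyclic graph. A vertex with an
  outgoing but no incoming edge has positive divergence, and only \<open>x\<close> can have
  that.\<close>

lemma single_source_reachable:
  assumes "finite E" "acyclic E" and pos: "\<And>e. e \<in> E \<Longrightarrow> 0 < w e"
    and flow: "\<And>v. netflow E w v = (if v = x then m else 0) - c v" and c: "\<And>v. 0 \<le> c v"
    and "(u, v) \<in> E"
  shows "(x, u) \<in> E\<^sup>*"
proof -
  have "wf E"
    using assms by (simp add: finite_acyclic_wf)
  then have "\<forall>v. (u, v) \<in> E \<longrightarrow> (x, u) \<in> E\<^sup>*"
  proof (induction u rule: wf_induct_rule)
    case (less u)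
    show ?case
    proof (intro allI impI)
      fix v assume uv: "(u, v) \<in> E"
      show "(x, u) \<in> E\<^sup>*"
      proof (cases "\<exists>t. (t, u) \<in> E")
        case True
        then show ?thesis
          using less by (meson rtrancl.rtrancl_into_rtrancl)
      next
        case False
        then have "{e\<in>E. snd e = u} = {}"
          by auto
        moreover have "0 < (\<Sum>e\<in>{e\<in>E. fst e = u}. w e)"
          using assms uv by (intro sum_pos2[of _ "(u, v)"]) (auto intro: less_imp_le)
        ultimately have "0 < netflow E w u"
          using \<open>finite E\<close> by (simp only: netflow_out_in sum.empty)
        then have "u = x"
          using flow[of u] c[of u] by (auto split: if_splits)
        then show ?thesis
          by simp
      qed
    qed
  qed
  then show ?thesis
    using assms by blast
qed

text \<open>In a tree rooted at \<open>x\<close>, the weight of the edge into a vertex is all that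
  the vertex receives. Targets only absorb mass, so the weights decrease along the path, from at
  most \<open>m\<close> down to at least the demand at \<open>y\<close>.\<close>

lemma tree_path:
  fixes E :: "('a::metric_space \<times> 'a) set"
  assumes fin: "finite E" and acyc: "acyclic E" and pos: "\<And>e. e \<in> E \<Longrightarrow> 0 < w e"
    and indeg: "\<And>u1 u2 v. (u1, v) \<in> E \<Longrightarrow> (u2, v) \<in> E \<Longrightarrow> u1 = u2"
    and flow: "\<And>v. netflow E w v = (if v = x then m else 0) - c v" and c: "\<And>v. 0 \<le> c v"
    and y: "(x, y) \<in> E\<^sup>*"
  obtains P where "P \<subseteq> E"
    "\<And>v. netflow E (\<lambda>e. of_bool (e \<in> P)) v = of_bool (v = x) - of_bool (v = y)"
    "dist x y \<le> (\<Sum>e\<in>P. dist (fst e) (snd e))"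
    "\<And>e. e \<in> P \<Longrightarrow> c y \<le> w e \<and> w e \<le> m"
proof -
  \<comment> \<open>Counting the supply at \<open>x\<close> as inflow gives conservation the same
    form at every vertex.\<close>
  define inflow where "inflow v = (\<Sum>e\<in>{e\<in>E. snd e = v}. w e) + (if v = x then m else 0)" for v
  have outflow: "(\<Sum>e\<in>{e\<in>E. fst e = v}. w e) = inflow v - c v" for v
    using flow[of v] fin by (simp add: netflow_out_in inflow_def)
  have no_cycle: "(v, v) \<notin> E\<^sup>+" for v
    using acyc by (simp add: acyclic_def)
  have out: "w (u, v) \<le> inflow u" if "(u, v) \<in> E" for u v
  proof -
    have "w (u, v) \<le> (\<Sum>e\<in>{e\<in>E. fst e = u}. w e)"
      using that fin pos by (intro member_le_sum) (auto intro: less_imp_le)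
    then show ?thesis
      using outflow[of u] c[of u] by simp
  qed
  have not_into_x: "(u, x) \<notin> E" for u
    using single_source_reachable[OF fin acyc pos flow c] no_cycle[of x]
    by (meson rtrancl_into_trancl1)
  have inflow_eq: "inflow v = w (u, v)" if "(u, v) \<in> E" for u v
  proof -
    have "{e\<in>E. snd e = v} = {(u, v)}"
      using that indeg by auto
    then show ?thesis
      using that not_into_x by (auto simp: inflow_def)
  qed
  have "inflow x = m"
    using not_into_x by (auto simp: inflow_def intro!: sum.neutral)
  \<comment> \<open>The induction needs the bound by \<open>inflow y\<close>, which is stronger than
    the one by \<open>c y\<close>, and reachability of \<open>y\<close>, which keeps the path from
    using an edge twice.\<close>
  have "\<exists>P\<subseteq>E. (\<forall>e\<in>P. (snd e, y) \<in> E\<^sup>*)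
      \<and> (\<forall>v. netflow E (\<lambda>e. of_bool (e \<in> P)) v = of_bool (v = x) - of_bool (v = y))
      \<and> dist x y \<le> (\<Sum>e\<in>P. dist (fst e) (snd e))
      \<and> (\<forall>e\<in>P. inflow y \<le> w e \<and> w e \<le> m) \<and> inflow y \<le> m"
    using y
  proof (induction rule: rtrancl_induct)
    case base
    then show ?case
      using \<open>inflow x = m\<close> by (intro exI[of _ "{}"]) (auto simp: netflow_def)
  next
    case (step v v')
    then obtain P where P: "P \<subseteq> E" "\<And>e. e \<in> P \<Longrightarrow> (snd e, v) \<in> E\<^sup>*"
      "\<And>z. netflow E (\<lambda>e. of_bool (e \<in> P)) z = of_bool (z = x) - of_bool (z = v)"
      "dist x v \<le> (\<Sum>e\<in>P. dist (fst e) (snd e))"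
      "\<And>e. e \<in> P \<Longrightarrow> inflow v \<le> w e \<and> w e \<le> m" "inflow v \<le> m"
      by blast
    have "(v, v') \<notin> P"
      using P(2)[of "(v, v')"] no_cycle[of v] step.hyps by (auto dest: rtrancl_into_trancl2)
    then have eq: "of_bool (e \<in> insert (v, v') P) = of_bool (e \<in> P) + (of_bool (e = (v, v')) :: real)" for e
      by auto
    have "finite P"
      using P(1) fin by (rule finite_subset)
    have "netflow E (\<lambda>e. of_bool (e \<in> insert (v, v') P)) z = of_bool (z = x) - of_bool (z = v')" for z
      unfolding eq using fin step.hyps by (simp add: netflow_add netflow_edge P)
    moreover have "dist x v' \<le> (\<Sum>e\<in>insert (v, v') P. dist (fst e) (snd e))"
      using dist_triangle[of x v' v] P(4) \<open>finite P\<close> \<open>(v, v') \<notin> P\<close> by simp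
    moreover have "\<forall>e\<in>insert (v, v') P. inflow v' \<le> w e \<and> w e \<le> m"
      using out[OF step.hyps(2)] inflow_eq[OF step.hyps(2)] P(5,6) by force
    moreover have "\<forall>e\<in>insert (v, v') P. (snd e, v') \<in> E\<^sup>*"
      using P(2) step.hyps by (auto intro: rtrancl_into_rtrancl)
    moreover have "inflow v' \<le> m"
      using out[OF step.hyps(2)] inflow_eq[OF step.hyps(2)] P(6) by simp
    ultimately show ?case
      using P(1) step.hyps by (intro exI[of _ "insert (v, v') P"]) auto
  qed
  moreover have "c y \<le> inflow y"
    using outflow[of y] sum_nonneg[of "{e\<in>E. fst e = y}" w] pos by (force intro: less_imp_le)
  ultimately show thesis
    using that by (meson order_trans)
qed

text \<open>Since \<open>d_cost\<close> is an infimum, the argument uses a path optimal up to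
  \<epsilon> and turns it into a forest without raising its cost.\<close>

lemma near_optimal_path:
  fixes c :: "'a::metric_space atomic_measure"
  assumes \<alpha>: "0 \<le> \<alpha>" "\<alpha> < 1" and c: "\<And>v. 0 \<le> Poly_Mapping.lookup c v"
    and y: "0 < Poly_Mapping.lookup c y" and "0 < \<epsilon>"
  obtains E w P where "finite E" "\<And>e. e \<in> E \<Longrightarrow> 0 < w e"
    "\<And>v. netflow E w v = (if v = x then mass c else 0) - Poly_Mapping.lookup c v"
    "M_cost \<alpha> E w < d_cost \<alpha> (Poly_Mapping.single x (mass c)) c + \<epsilon>"
    "P \<subseteq> E"
    "\<And>v. netflow E (\<lambda>e. of_bool (e \<in> P)) v = of_bool (v = x) - of_bool (v = y)"
    "dist x y \<le> (\<Sum>e\<in>P. dist (fst e) (snd e))"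
    "\<And>e. e \<in> P \<Longrightarrow> Poly_Mapping.lookup c y \<le> w e \<and> w e \<le> mass c"
proof -
  let ?a = "Poly_Mapping.single x (mass c)"
  let ?A = "{M_cost \<alpha> E w | V E w. transport_path ?a c V E w}"
  have "?A \<noteq> {}"
  proof -
    obtain V E w where "transport_path ?a c V E w"
      using exists_transport_path[OF c] .
    then show ?thesis
      by blast
  qed
  moreover have "Inf ?A < d_cost \<alpha> ?a c + \<epsilon>"
    using \<open>0 < \<epsilon>\<close> by (simp add: d_cost_def)
  ultimately obtain V0 E0 w0 where 0: "transport_path ?a c V0 E0 w0"
    "M_cost \<alpha> E0 w0 < d_cost \<alpha> ?a c + \<epsilon>"
    using cInf_lessD[of ?A] by blast
  have "finite E0" "\<And>e. e \<in> E0 \<Longrightarrow> 0 < w0 e"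
    using 0(1) by (auto simp: transport_path_def)
  then obtain E w where E: "finite E" "circulation_free E" "\<And>e. e \<in> E \<Longrightarrow> 0 < w e"
    "\<And>v. netflow E w v = netflow E0 w0 v" "M_cost \<alpha> E w \<le> M_cost \<alpha> E0 w0"
    using reduce_to_circulation_free[of \<alpha> E0 w0] \<alpha> by metis
  have flow: "netflow E w v = (if v = x then mass c else 0) - Poly_Mapping.lookup c v" for v
    using transport_path_netflow[OF 0(1), of v] E(4) by (simp add: lookup_single when_def)
  note acyc = circulation_free_acyclic[OF E(1,2)]
  note reach = single_source_reachable[OF E(1) acyc E(3) flow c]
  have xy: "(x, y) \<in> E\<^sup>*"
  proof (cases "y = x")
    case False
    have "0 \<le> (\<Sum>e\<in>{e\<in>E. fst e = y}. w e)"
      using E(3) by (intro sum_nonneg) (auto intro: less_imp_le)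
    then have "(\<Sum>e\<in>{e\<in>E. snd e = y}. w e) \<noteq> 0"
      using flow[of y] y False E(1) by (simp add: netflow_out_in)
    then have "{e\<in>E. snd e = y} \<noteq> {}"
      by (metis sum.empty)
    then show ?thesis
      using reach by (auto intro: rtrancl_into_rtrancl)
  qed simp
  have indeg: "u1 = u2" if "(u1, v) \<in> E" "(u2, v) \<in> E" for u1 u2 v
    using circulation_free_indegree[OF E(1,2) that] reach that by blast
  obtain P where "P \<subseteq> E"
    "\<And>v. netflow E (\<lambda>e. of_bool (e \<in> P)) v = of_bool (v = x) - of_bool (v = y)"
    "dist x y \<le> (\<Sum>e\<in>P. dist (fst e) (snd e))"
    "\<And>e. e \<in> P \<Longrightarrow> Poly_Mapping.lookup c y \<le> w e \<and> w e \<le> mass c"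
    by (rule tree_path[OF E(1) acyc _ _ flow c xy])
      ((erule E(3) | (erule indeg, assumption) | (rule that; iprover))+)
  then show thesis
    using that[of E w P] E flow 0(2) by force
qed

subsection \<open>Moving mass along a path\<close>

lemma M_cost_change_path:
  assumes "finite E" "P \<subseteq> E"
  shows "M_cost \<alpha> E (\<lambda>e. w e + r * of_bool (e \<in> P))
    = M_cost \<alpha> E w + (\<Sum>e\<in>P. ((w e + r) powr \<alpha> - w e powr \<alpha>) * dist (fst e) (snd e))"
proof -
  have "(\<Sum>e\<in>P. ((w e + r) powr \<alpha> - w e powr \<alpha>) * dist (fst e) (snd e))
      = (\<Sum>e\<in>E. (w e + r * of_bool (e \<in> P)) powr \<alpha> * dist (fst e) (snd e) - w e powr \<alpha> * dist (fst e) (snd e))"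
    using assms by (intro sum.mono_neutral_cong_left) (auto simp: algebra_simps)
  then show ?thesis
    by (simp add: M_cost_def sum_subtractf)
qed

text \<open>By concavity, the saving on an edge is smallest when its weight is largest, that is, at
  \<open>m\<close>.\<close>

lemma M_cost_remove_path:
  assumes \<alpha>: "0 \<le> \<alpha>" "\<alpha> < 1" and "finite E" "P \<subseteq> E" "0 < r"
    and w: "\<And>e. e \<in> P \<Longrightarrow> r \<le> w e \<and> w e \<le> m"
  shows "M_cost \<alpha> E (\<lambda>e. w e + (- r) * of_bool (e \<in> P))
    + r powr \<alpha> * rho \<alpha> m r * (\<Sum>e\<in>P. dist (fst e) (snd e)) \<le> M_cost \<alpha> E w"
proof -
  have "r powr \<alpha> * rho \<alpha> m r * (\<Sum>e\<in>P. dist (fst e) (snd e))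
      \<le> (\<Sum>e\<in>P. - (((w e + (- r)) powr \<alpha> - w e powr \<alpha>) * dist (fst e) (snd e)))"
    unfolding sum_distrib_left
  proof (rule sum_mono)
    fix e assume "e \<in> P"
    then have "r \<le> w e" "w e \<le> m" using w by auto
    then have "r powr \<alpha> * rho \<alpha> m r \<le> w e powr \<alpha> - (w e - r) powr \<alpha>"
      using rho_scaled[of r m \<alpha>] powr_increment_antimono[OF \<alpha> \<open>0 < r\<close>, of "w e" m] \<open>0 < r\<close> by simp
    then have "r powr \<alpha> * rho \<alpha> m r * dist (fst e) (snd e)
      \<le> (w e powr \<alpha> - (w e - r) powr \<alpha>) * dist (fst e) (snd e)"
      by (rule mult_right_mono) simp
    then show "r powr \<alpha> * rho \<alpha> m r * dist (fst e) (snd e)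
      \<le> - (((w e + (- r)) powr \<alpha> - w e powr \<alpha>) * dist (fst e) (snd e))"
      by (simp add: algebra_simps)
  qed
  then show ?thesis
    using assms by (simp only: M_cost_change_path sum_negf)
qed

text \<open>By concavity, the extra cost on an edge is largest when its weight is smallest, that is,
  at \<open>t\<close>.\<close>

lemma M_cost_add_path:
  assumes \<alpha>: "0 \<le> \<alpha>" "\<alpha> < 1" and "finite E" "P \<subseteq> E" "0 < r" "0 < t"
    and w: "\<And>e. e \<in> P \<Longrightarrow> t \<le> w e"
  shows "M_cost \<alpha> E (\<lambda>e. w e + r * of_bool (e \<in> P))
    \<le> M_cost \<alpha> E w + r powr \<alpha> * rho \<alpha> (t + r) r * (\<Sum>e\<in>P. dist (fst e) (snd e))"
proof -
  have "(\<Sum>e\<in>P. ((w e + r) powr \<alpha> - w e powr \<alpha>) * dist (fst e) (snd e))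
     \<le> r powr \<alpha> * rho \<alpha> (t + r) r * (\<Sum>e\<in>P. dist (fst e) (snd e))"
    unfolding sum_distrib_left
  proof (rule sum_mono)
    fix e assume "e \<in> P"
    then have "(w e + r) powr \<alpha> - w e powr \<alpha> \<le> r powr \<alpha> * rho \<alpha> (t + r) r"
      using rho_scaled[of r "t + r" \<alpha>] powr_increment_antimono[OF \<alpha> \<open>0 < r\<close>, of "t + r" "w e + r"]
        w assms(5,6) by simp
    then show "((w e + r) powr \<alpha> - w e powr \<alpha>) * dist (fst e) (snd e)
        \<le> r powr \<alpha> * rho \<alpha> (t + r) r * dist (fst e) (snd e)"
      by (rule mult_right_mono) simp
  qed
  then show ?thesis
    using assms by (simp add: M_cost_change_path)
qed

text \<open>The path to \<open>y\<close> in a nearly optimal tree carries at least \<open>r\<close>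
  on each edge, so \<open>r\<close> can be taken off all of it. Its length is at least
  \<open>dist x y\<close>, and nonnegativity of \<rho> lets this distance replace the
  length.\<close>

lemma d_cost_remove_target:
  fixes c c' :: "'a::metric_space atomic_measure"
  assumes \<alpha>: "0 \<le> \<alpha>" "\<alpha> < 1" and c: "\<And>v. 0 \<le> Poly_Mapping.lookup c v"
    and r: "0 < r" "r \<le> Poly_Mapping.lookup c y"
    and a': "\<And>v. Poly_Mapping.lookup a' v = (if v = x then mass c - r else 0)"
    and c': "\<And>v. Poly_Mapping.lookup c' v = Poly_Mapping.lookup c v - r * of_bool (v = y)"
  shows "d_cost \<alpha> a' c' + r powr \<alpha> * rho \<alpha> (mass c) r * dist x y
    \<le> d_cost \<alpha> (Poly_Mapping.single x (mass c)) c"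
proof (rule field_le_epsilon)
  fix \<epsilon> :: real assume "0 < \<epsilon>"
  obtain E w P where E: "finite E" "\<And>e. e \<in> E \<Longrightarrow> 0 < w e"
    "\<And>v. netflow E w v = (if v = x then mass c else 0) - Poly_Mapping.lookup c v"
    "M_cost \<alpha> E w < d_cost \<alpha> (Poly_Mapping.single x (mass c)) c + \<epsilon>"
    "P \<subseteq> E"
    "\<And>v. netflow E (\<lambda>e. of_bool (e \<in> P)) v = of_bool (v = x) - of_bool (v = y)"
    "dist x y \<le> (\<Sum>e\<in>P. dist (fst e) (snd e))"
    "\<And>e. e \<in> P \<Longrightarrow> Poly_Mapping.lookup c y \<le> w e \<and> w e \<le> mass c"
    by (rule near_optimal_path[OF \<alpha> c order_less_le_trans[OF r] \<open>0 < \<epsilon>\<close>, of x]) (rule that; iprover)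
  have w: "r \<le> w e \<and> w e \<le> mass c" if "e \<in> P" for e
    using E(8)[OF that] r by simp
  have "d_cost \<alpha> a' c' \<le> M_cost \<alpha> E (\<lambda>e. w e + (- r) * of_bool (e \<in> P))"
  proof (intro d_cost_le_flow \<alpha> E(1))
    show "0 \<le> w e + (- r) * of_bool (e \<in> P)" if "e \<in> E" for e
      using w[of e] E(2)[OF that] by auto
    show "netflow E (\<lambda>e. w e + (- r) * of_bool (e \<in> P)) v
      = Poly_Mapping.lookup a' v - Poly_Mapping.lookup c' v" for v
      by (simp only: netflow_add netflow_scale E a' c') (simp add: algebra_simps)
  qed
  moreover have "r powr \<alpha> * rho \<alpha> (mass c) r * dist x y
      \<le> r powr \<alpha> * rho \<alpha> (mass c) r * (\<Sum>e\<in>P. dist (fst e) (snd e))" if "0 \<le> rho \<alpha> (mass c) r"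
    using E(7) that by (intro mult_left_mono) auto
  moreover have "0 \<le> rho \<alpha> (mass c) r"
  proof (cases "\<alpha> = 0")
    case False
    have "Poly_Mapping.lookup c y \<le> mass c"
      unfolding mass_def using c r by (intro member_le_sum) (auto simp: in_keys_iff)
    then show ?thesis
      using rho_pos[of \<alpha> r "mass c"] r False \<alpha> by simp
  qed (simp add: rho_def)
  ultimately show "d_cost \<alpha> a' c' + r powr \<alpha> * rho \<alpha> (mass c) r * dist x y
    \<le> d_cost \<alpha> (Poly_Mapping.single x (mass c)) c + \<epsilon>"
    using M_cost_remove_path[OF \<alpha> E(1,5) r(1), of w "mass c"] w E(4) by simp
qed

text \<open>Rerouting mass \<open>r\<close> directly from \<open>x\<close> to \<open>z\<close> cannot lower an optimal cost, which bounds the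
  length of the path from \<open>x\<close> to \<open>z\<close>. The new atom at \<open>y\<close> is served along this path, with one
  further edge from \<open>z\<close> to \<open>y\<close>.\<close>

lemma d_cost_add_target:
  fixes c c' :: "'a::metric_space atomic_measure"
  assumes \<alpha>: "0 \<le> \<alpha>" "\<alpha> < 1" and c: "\<And>v. 0 \<le> Poly_Mapping.lookup c v"
    and r: "0 < r" "r \<le> t" "t \<le> Poly_Mapping.lookup c z"
    and a': "\<And>v. Poly_Mapping.lookup a' v = (if v = x then mass c + r else 0)"
    and c': "\<And>v. Poly_Mapping.lookup c' v = Poly_Mapping.lookup c v + r * of_bool (v = y)"
  shows "d_cost \<alpha> a' c' \<le> d_cost \<alpha> (Poly_Mapping.single x (mass c)) c
    + r powr \<alpha> * (dist z y + rho \<alpha> (t + r) r / rho \<alpha> (mass c) r * dist x z)"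
proof -
  let ?d = "d_cost \<alpha> (Poly_Mapping.single x (mass c)) c"
  define q where "q = rho \<alpha> (t + r) r / rho \<alpha> (mass c) r"
  have mass: "r \<le> mass c"
  proof -
    have "Poly_Mapping.lookup c z \<le> mass c"
      unfolding mass_def using c r by (intro member_le_sum) (auto simp: in_keys_iff)
    then show ?thesis using r by simp
  qed
  have rho: "\<alpha> = 0 \<or> 0 < rho \<alpha> (mass c) r \<and> 0 < rho \<alpha> (t + r) r"
    using rho_pos[of \<alpha> r "mass c"] rho_pos[of \<alpha> r "t + r"] r \<alpha> mass by auto
  \<comment> \<open>As \<open>t\<close> is positive, \<open>t + r\<close> differs from
    \<open>r\<close>. For \<alpha> = 0 the numerator thus vanishes, and so does the quotient
    whatever its denominator.\<close>
  have rho0: "rho \<alpha> (t + r) r = 0" if "\<alpha> = 0"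
    using that r by (simp add: rho_def)
  have z: "0 < Poly_Mapping.lookup c z"
    using r by simp
  have "0 \<le> q"
    using rho rho0 by (auto simp: q_def)
  \<comment> \<open>One \<epsilon> comes from the cost of the nearly optimal tree, and
    \<open>q\<close> times \<epsilon> from the bound on the length of its path.\<close>
  have bound: "d_cost \<alpha> a' c' \<le> (?d + r powr \<alpha> * (dist z y + q * dist x z)) + (1 + q) * \<epsilon>"
    if "0 < \<epsilon>" for \<epsilon>
  proof -
    obtain E w P where E: "finite E" "\<And>e. e \<in> E \<Longrightarrow> 0 < w e"
      "\<And>v. netflow E w v = (if v = x then mass c else 0) - Poly_Mapping.lookup c v"
      "M_cost \<alpha> E w < ?d + \<epsilon>" "P \<subseteq> E"
      "\<And>v. netflow E (\<lambda>e. of_bool (e \<in> P)) v = of_bool (v = x) - of_bool (v = z)"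
      "\<And>e. e \<in> P \<Longrightarrow> Poly_Mapping.lookup c z \<le> w e \<and> w e \<le> mass c"
      by (rule near_optimal_path[OF \<alpha> c z \<open>0 < \<epsilon>\<close>, of x]) (rule that; iprover)
    define L where "L = (\<Sum>e\<in>P. dist (fst e) (snd e))"
    have w: "t \<le> w e" "r \<le> w e \<and> w e \<le> mass c" if "e \<in> P" for e
      using E(7)[OF that] r by auto
    have "?d \<le> M_cost \<alpha> E (\<lambda>e. w e + (- r) * of_bool (e \<in> P)) + r powr \<alpha> * dist x z"
    proof (intro d_cost_le_flow_plus_edge \<alpha> E(1))
      show "0 \<le> w e + (- r) * of_bool (e \<in> P)" if "e \<in> E" for e
        using w[of e] E(2)[OF that] by auto
      show "netflow E (\<lambda>e. w e + (- r) * of_bool (e \<in> P)) v + r * (of_bool (v = x) - of_bool (v = z))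
        = Poly_Mapping.lookup (Poly_Mapping.single x (mass c)) v - Poly_Mapping.lookup c v" for v
        by (simp only: netflow_add netflow_scale E) (simp add: lookup_single when_def algebra_simps)
    qed (use r in simp)
    \<comment> \<open>Removing \<open>r\<close> from the path saves at least the left-hand side,
      while the rerouted flow still costs at least \<open>?d\<close> in total; the difference is
      paid by the direct edge and \<epsilon>.\<close>
    then have L: "r powr \<alpha> * rho \<alpha> (mass c) r * L \<le> r powr \<alpha> * dist x z + \<epsilon>"
      using M_cost_remove_path[OF \<alpha> E(1,5) r(1), of w "mass c"] w(2) E(4) by (simp add: L_def)
    have "r powr \<alpha> * rho \<alpha> (t + r) r * L \<le> q * (r powr \<alpha> * dist x z + \<epsilon>)"
    proof (cases "\<alpha> = 0")
      case True
      then show ?thesis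
        unfolding q_def rho0[OF True] by simp
    next
      case False
      then have "r powr \<alpha> * rho \<alpha> (t + r) r * L = q * (r powr \<alpha> * rho \<alpha> (mass c) r * L)"
        using rho by (simp add: q_def)
      then show ?thesis
        using L \<open>0 \<le> q\<close> by (metis mult_left_mono)
    qed
    moreover have "d_cost \<alpha> a' c'
      \<le> M_cost \<alpha> E (\<lambda>e. w e + r * of_bool (e \<in> P)) + r powr \<alpha> * dist z y"
    proof (intro d_cost_le_flow_plus_edge \<alpha> E(1))
      show "0 \<le> w e + r * of_bool (e \<in> P)" if "e \<in> E" for e
        using r E(2)[OF that] by simp
      show "netflow E (\<lambda>e. w e + r * of_bool (e \<in> P)) v + r * (of_bool (v = z) - of_bool (v = y))
        = Poly_Mapping.lookup a' v - Poly_Mapping.lookup c' v" for v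
        by (simp only: netflow_add netflow_scale E a' c') (simp add: algebra_simps)
    qed (use r in simp)
    moreover have "M_cost \<alpha> E (\<lambda>e. w e + r * of_bool (e \<in> P))
      \<le> M_cost \<alpha> E w + r powr \<alpha> * rho \<alpha> (t + r) r * L"
      unfolding L_def using r w by (intro M_cost_add_path \<alpha> E) auto
    ultimately show ?thesis
      using E(4) by (simp add: algebra_simps)
  qed
  show ?thesis
    unfolding q_def[symmetric]
  proof (rule field_le_epsilon)
    fix \<delta> :: real assume "0 < \<delta>"
    then show "d_cost \<alpha> a' c' \<le> ?d + r powr \<alpha> * (dist z y + q * dist x z) + \<delta>"
      using bound[of "\<delta> / (1 + q)"] \<open>0 \<le> q\<close> by simp
  qed
qed

subsection \<open>Changing an assignment map\<close>

lemma mass_superset: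
  assumes "finite A" "Poly_Mapping.keys c \<subseteq> A"
  shows "mass c = (\<Sum>z\<in>A. Poly_Mapping.lookup c z)"
  unfolding mass_def using assms by (intro sum.mono_neutral_left) (auto simp: in_keys_iff)

lemma finite_fiber [simp]: "finite (fiber l S i)"
  by (simp add: fiber_def)

lemma lookup_target_part:
  "Poly_Mapping.lookup (target_part l S n y i) v = (\<Sum>j\<in>fiber l S i. n j * of_bool (y j = v))"
  unfolding target_part_def lookup_sum by (intro sum.cong) (auto simp: lookup_single)

lemma mass_target_part: "mass (target_part l S n y i) = (\<Sum>j\<in>fiber l S i. n j)"
proof -
  let ?A = "y ` fiber l S i"
  have "Poly_Mapping.keys (target_part l S n y i) \<subseteq> ?A"
  proof
    fix v assume "v \<in> Poly_Mapping.keys (target_part l S n y i)"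
    then show "v \<in> ?A"
      unfolding in_keys_iff lookup_target_part by (rule contrapos_np) (auto intro!: sum.neutral)
  qed
  then have "mass (target_part l S n y i) = (\<Sum>v\<in>?A. \<Sum>j\<in>fiber l S i. n j * of_bool (y j = v))"
    by (subst mass_superset[of ?A]) (auto simp: lookup_target_part)
  also have "\<dots> = (\<Sum>j\<in>fiber l S i. \<Sum>v\<in>?A. if v = y j then n j else 0)"
    by (subst sum.swap) (intro sum.cong, auto)
  also have "\<dots> = (\<Sum>j\<in>fiber l S i. n j)"
    by (intro sum.cong) auto
  finally show ?thesis .
qed

text \<open>The common core of both claims, in contrapositive form. Moving \<open>j\<close> changes
  only the summands of \<open>s\<close> and \<open>s'\<close>, so optimality compares the saving at
  \<open>s\<close> with the extra cost at \<open>s'\<close>.\<close>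

lemma optimal_assignment_exchange:
  fixes x y :: "nat \<Rightarrow> 'a::metric_space"
  assumes \<alpha>: "0 \<le> \<alpha>" "\<alpha> < 1" and n: "\<And>i. i \<in> {1..l} \<Longrightarrow> 0 < n i"
    and opt: "optimal_assignment \<alpha> l k x n y S"
    and hj: "h \<in> {1..l}" "j \<in> {1..l}" "n j \<le> n h"
    and S: "S h = s'" "S j = s" "s \<noteq> s'"
  shows "rho \<alpha> (mass (target_part l S n y s)) (n j) * dist (y j) (x s) \<le> dist (y j) (y h)
    + rho \<alpha> (n h + n j) (n j) / rho \<alpha> (mass (target_part l S n y s')) (n j) * dist (y h) (x s')"
proof -
  define T where "T = S(j := s')"
  let ?d = "\<lambda>S i. d_cost \<alpha> (source_part l S x n i) (target_part l S n y i)"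
  have SM: "S \<in> Maps l k"
    using opt by (simp add: optimal_assignment_def)
  have ss: "s \<in> {1..k}" "s' \<in> {1..k}"
    using SM hj S by (auto simp: Maps_def)
  have "T \<in> Maps l k"
    using SM ss hj by (auto simp: Maps_def T_def PiE_iff extensional_def)
  then have le: "(\<Sum>i=1..k. ?d S i) \<le> (\<Sum>i=1..k. ?d T i)"
    using opt by (simp add: optimal_assignment_def assignment_cost_def)
  have nj: "0 < n j"
    using n hj by simp
  have fs: "fiber l T s = fiber l S s - {j}" "j \<in> fiber l S s"
    and fs': "fiber l T s' = insert j (fiber l S s')" "j \<notin> fiber l S s'" "h \<in> fiber l S s'"
    and fi: "i \<noteq> s \<Longrightarrow> i \<noteq> s' \<Longrightarrow> fiber l T i = fiber l S i" for i
    using S hj by (auto simp: fiber_def T_def)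
  have source: "source_part l S x n i = Poly_Mapping.single (x i) (mass (target_part l S n y i))" for S i
    by (simp add: source_part_def mass_target_part)
  have nonneg: "0 \<le> Poly_Mapping.lookup (target_part l S n y i) v" for i v
    unfolding lookup_target_part using n by (intro sum_nonneg) (force simp: fiber_def)
  \<comment> \<open>Only an inequality, since several indices may share the same location.\<close>
  have atom: "n p \<le> Poly_Mapping.lookup (target_part l S n y i) (y p)" if "p \<in> fiber l S i" for p i
  proof -
    have "n p * of_bool (y p = y p) \<le> (\<Sum>j\<in>fiber l S i. n j * of_bool (y j = y p))"
      using that n by (intro member_le_sum[of p]) (auto simp: fiber_def intro: less_imp_le)
    then show ?thesis
      by (simp add: lookup_target_part)
  qed
  have split: "(\<Sum>i=1..k. f i) = f s + f s' + (\<Sum>i\<in>{1..k} - {s, s'}. f i)" for f :: "nat \<Rightarrow> real"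
    using sum.subset_diff[of "{s, s'}" "{1..k}" f] ss S(3) by simp
  have "(\<Sum>i\<in>{1..k} - {s, s'}. ?d S i) = (\<Sum>i\<in>{1..k} - {s, s'}. ?d T i)"
    by (intro sum.cong) (auto simp: source_part_def target_part_def fi)
  then have exchange: "?d S s + ?d S s' \<le> ?d T s + ?d T s'"
    using le unfolding split[of "?d S"] split[of "?d T"] by linarith
  have "?d T s + n j powr \<alpha> * rho \<alpha> (mass (target_part l S n y s)) (n j) * dist (x s) (y j) \<le> ?d S s"
    unfolding source[of S]
  proof (intro d_cost_remove_target \<alpha> nonneg nj atom fs)
    show "Poly_Mapping.lookup (source_part l T x n s) v
        = (if v = x s then mass (target_part l S n y s) - n j else 0)" for v
      using fs by (simp add: source_part_def mass_target_part lookup_single when_def sum_diff1)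
    show "Poly_Mapping.lookup (target_part l T n y s) v
        = Poly_Mapping.lookup (target_part l S n y s) v - n j * of_bool (v = y j)" for v
      using sum.remove[OF finite_fiber fs(2), of "\<lambda>i. n i * of_bool (y i = v)"]
      by (simp add: lookup_target_part fs eq_commute[of v] del: sum_mult_of_bool_eq)
  qed
  \<comment> \<open>The path to be extended is the one to \<open>y h\<close>, whose edges carry at
    least \<open>n h\<close>; this is where \<open>n j \<le> n h\<close> enters.\<close>
  moreover have "?d T s' \<le> ?d S s' + n j powr \<alpha> * (dist (y h) (y j)
    + rho \<alpha> (n h + n j) (n j) / rho \<alpha> (mass (target_part l S n y s')) (n j) * dist (x s') (y h))"
    unfolding source[of S]
  proof (intro d_cost_add_target \<alpha> nonneg nj hj atom fs')
    show "Poly_Mapping.lookup (source_part l T x n s') v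
        = (if v = x s' then mass (target_part l S n y s') + n j else 0)" for v
      using fs' by (simp add: source_part_def mass_target_part lookup_single when_def)
    show "Poly_Mapping.lookup (target_part l T n y s') v
        = Poly_Mapping.lookup (target_part l S n y s') v + n j * of_bool (v = y j)" for v
      using fs' by (simp add: lookup_target_part eq_commute[of v] del: sum_mult_of_bool_eq)
  qed
  ultimately have "n j powr \<alpha> * (rho \<alpha> (mass (target_part l S n y s)) (n j) * dist (x s) (y j))
    \<le> n j powr \<alpha> * (dist (y h) (y j)
    + rho \<alpha> (n h + n j) (n j) / rho \<alpha> (mass (target_part l S n y s')) (n j) * dist (x s') (y h))"
    using exchange by (simp add: mult.assoc)
  then show ?thesis
    using nj by (simp add: mult_le_cancel_left_pos dist_commute)
qed

theorem theorem3:
  fixes X :: "(real ^ 'm) set"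
    and x y :: "nat \<Rightarrow> real ^ 'm"
    and n :: "nat \<Rightarrow> real"
    and k l h j :: nat
    and \<alpha> :: real
    and S :: "nat \<Rightarrow> nat"
  assumes "compact X" and "convex X"
    and "\<forall>i\<in>{1..k}. x i \<in> X"
    and "\<forall>i\<in>{1..l}. y i \<in> X"
    and "\<forall>i\<in>{1..l}. n i > 0"
    and "(\<Sum>i=1..l. n i) = 1"
    and "0 \<le> \<alpha>" and "\<alpha> < 1"
    and "optimal_assignment \<alpha> l k x n y S"
    and "h \<in> {1..l}" and "j \<in> {1..l}" and "n j \<le> n h"
  shows
    "(\<forall>s\<in>{1..k}. \<forall>s'\<in>{1..k}.
        S h = s' \<and> s' \<noteq> s \<and> mass (target_part l S n y s) \<ge> n j \<and>
        norm (y j - y h)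
          + rho \<alpha> (n h + n j) (n j) / rho \<alpha> (mass (target_part l S n y s')) (n j) * norm (y h - x s')
          < rho \<alpha> (mass (target_part l S n y s)) (n j) * norm (y j - x s)
        \<longrightarrow> S j \<noteq> s)
     \<and>
     (\<forall>s\<in>{1..k}.
        S h = s \<and>
        (\<forall>i\<in>{1..k}. i \<noteq> s \<and> mass (target_part l S n y i) \<ge> n j \<longrightarrow>
           norm (y j - y h)
             + rho \<alpha> (n h + n j) (n j) / rho \<alpha> (mass (target_part l S n y s)) (n j) * norm (y h - x s)
             < rho \<alpha> (mass (target_part l S n y i)) (n j) * norm (y j - x i))
        \<longrightarrow> S j = s)"
proof (intro conjI ballI impI; elim conjE)
  note exchange = optimal_assignment_exchange[OF assms(7,8) _ assms(9-12)]
  have n: "\<And>i. i \<in> {1..l} \<Longrightarrow> 0 < n i"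
    using assms(5) by blast
  {
    fix s s'
    assume *: "S h = s'" "s' \<noteq> s" "norm (y j - y h)
        + rho \<alpha> (n h + n j) (n j) / rho \<alpha> (mass (target_part l S n y s')) (n j) * norm (y h - x s')
        < rho \<alpha> (mass (target_part l S n y s)) (n j) * norm (y j - x s)"
    show "S j \<noteq> s"
    proof
      assume "S j = s"
      from exchange[OF n *(1) this *(2)[symmetric]] *(3) show False
        by (simp add: dist_norm)
    qed
  }
  fix s
  assume "S h = s" and far: "\<forall>i\<in>{1..k}. i \<noteq> s \<and> n j \<le> mass (target_part l S n y i) \<longrightarrow>
      norm (y j - y h)
        + rho \<alpha> (n h + n j) (n j) / rho \<alpha> (mass (target_part l S n y s)) (n j) * norm (y h - x s)
        < rho \<alpha> (mass (target_part l S n y i)) (n j) * norm (y j - x i)"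
  show "S j = s"
  proof (rule ccontr)
    assume "S j \<noteq> s"
    have "S j \<in> {1..k}"
      using assms(9,11) by (auto simp: optimal_assignment_def Maps_def)
    \<comment> \<open>The index \<open>j\<close> lies in its own fiber, so the hypothesis applies to
      the index \<open>S j\<close>.\<close>
    moreover have "n j \<le> mass (target_part l S n y (S j))"
      unfolding mass_target_part using assms(11) n
      by (intro member_le_sum) (auto simp: fiber_def intro: less_imp_le)
    ultimately have "norm (y j - y h)
        + rho \<alpha> (n h + n j) (n j) / rho \<alpha> (mass (target_part l S n y s)) (n j) * norm (y h - x s)
        < rho \<alpha> (mass (target_part l S n y (S j))) (n j) * norm (y j - x (S j))"
      using far \<open>S j \<noteq> s\<close> by blast
    then show False
      using exchange[OF n \<open>S h = s\<close> refl \<open>S j \<noteq> s\<close>] by (simp add: dist_norm)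
  qed
qed

end
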